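(* For a positive integer $k$, let $f(k)$ denote the smallest integer $m$ such that every $K_{k+1}$-free disjointness graph of a finite family of $x$-monotone curves in the plane can be properly colored with $m$ colors. Then $$\frac{k+1}{2}\binom{k+2}{3}\leq f(k)\leq k^{2}\binom{k+1}{2}.$$
   Context: A curve is the image of a continuous map $\phi:[0,1]\to\mathbb{R}^2$. A curve is $x$-monotone if every vertical line meets it in at most one point. The disjointness graph of a family of curves has the curves as vertices, two vertices being adjacent if and only if the corresponding curves are disjoint. A graph is $K_{k+1}$-free if it contains no clique on $k+1$ vertices. *)

theory Defs
  imports "HOL-Analysis.Analysis" "HOL-Library.Ramsey"
begin

definition curve :: "(real \<times> real) set \<Rightarrow> bool" where
  "curve C \<longleftrightarrow> (\<exists>\<phi>. path \<phi> \<and> C = path_image \<phi>)"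

definition x_monotone :: "(real \<times> real) set \<Rightarrow> bool" where
  "x_monotone C \<longleftrightarrow> (\<forall>a. \<exists>\<^sub>\<le>\<^sub>1 p. p \<in> C \<and> fst p = a)"

text \<open>Graphs are given by a vertex set and a set of two-element edges, which is the convention
  of the predicate \<open>clique\<close> of \<^theory>\<open>HOL-Library.Ramsey\<close>. The vertices of the
  disjointness graph of a family \<open>F\<close> are the members of \<open>F\<close>; a family is a set, since curves
  occurring repeatedly would intersect each other and could share a color.\<close>

definition disjointness_edges :: "'a set set \<Rightarrow> 'a set set set" where
  "disjointness_edges F = {{C, D} | C D. C \<in> F \<and> D \<in> F \<and> C \<noteq> D \<and> disjnt C D}"

definition complete_free :: "nat \<Rightarrow> 'v set \<Rightarrow> 'v set set \<Rightarrow> bool" where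
  "complete_free n V E \<longleftrightarrow> \<not> (\<exists>S \<subseteq> V. card S = n \<and> clique S E)"

definition proper_coloring :: "('v \<Rightarrow> nat) \<Rightarrow> nat \<Rightarrow> 'v set \<Rightarrow> 'v set set \<Rightarrow> bool" where
  "proper_coloring c m V E \<longleftrightarrow>
     c ` V \<subseteq> {..<m} \<and> (\<forall>u\<in>V. \<forall>v\<in>V. {u, v} \<in> E \<longrightarrow> c u \<noteq> c v)"

definition colors_suffice :: "nat \<Rightarrow> nat \<Rightarrow> bool" where
  "colors_suffice k m \<longleftrightarrow>
     (\<forall>F. finite F \<longrightarrow> (\<forall>C\<in>F. curve C \<and> x_monotone C) \<longrightarrow>
        complete_free (k + 1) F (disjointness_edges F) \<longrightarrow>
        (\<exists>c. proper_coloring c m F (disjointness_edges F)))"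

text \<open>\<^const>\<open>Least\<close> is unspecified if no number of colors suffices, so statements about
  \<open>color_bound k\<close> are only meaningful together with \<open>\<exists>m. colors_suffice k m\<close>.\<close>

definition color_bound :: "nat \<Rightarrow> nat" where
  "color_bound k = (LEAST m. colors_suffice k m)"

end

theory Submission
  imports Defs "HOL-Library.List_Lexorder"
begin

text \<open>Upper bound. An \<open>x\<close>-monotone curve is the graph of a continuous function on an interval, and of two
  disjoint curves one lies below the other over the common part of their intervals. Comparing the
  endpoints of the intervals splits this relation into four strict orders: both endpoints move right,
  both move left, the lower interval is contained in the upper one, or it contains it. The chains of
  these orders are cliques. A vertex is colored by its heights in the four orders. For the last two,
  chains ascending to a vertex \<open>v\<close> with growing intervals and chains ascending from \<open>v\<close> with shrinking
  intervals combine to a clique, because the interval of \<open>v\<close> contains all the others; hence the sum of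
  these two heights is at most \<open>k + 1\<close>.

  Lower bound. All curves cross the \<open>y\<close>-axis, and two of them are disjoint if and only if their left
  parts are disjoint and their right parts are. A relation that is compatible with the order along the
  axis is realized by the right parts as soon as it is transitive at every middle curve that is not the
  shortest of the three. Start from Zykov's graph with \<open>N\<close> color classes, viewed as the cover graph
  of a poset whose intervals are chains and whose levels are the color classes, and choose the left and
  right lengths by the level. The required closure of the edges adds only pairs of comparable vertices,
  and a clique is a chain along which neither length has a valley. So \<open>N\<close> colors are needed as soon as
  there is a sequence of \<open>N\<close> pairs of lengths whose valley-free subsequences have at most \<open>k\<close> terms.\<close>

section \<open>Coloring by heights in four orders\<close>

lemma doubleton_in_disjointness_edges_iff:
  "{C, D} \<in> disjointness_edges F \<longleftrightarrow> C \<in> F \<and> D \<in> F \<and> C \<noteq> D \<and> disjnt C D"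
proof
  show "{C, D} \<in> disjointness_edges F \<Longrightarrow> C \<in> F \<and> D \<in> F \<and> C \<noteq> D \<and> disjnt C D"
    by (auto simp: disjointness_edges_def doubleton_eq_iff disjnt_def Int_commute)
qed (auto simp: disjointness_edges_def)

lemma card_le_if_complete_free:
  assumes free: "complete_free (k + 1) F (disjointness_edges F)" and "finite S" "S \<subseteq> F"
    and disj: "\<And>C D. C \<in> S \<Longrightarrow> D \<in> S \<Longrightarrow> C \<noteq> D \<Longrightarrow> disjnt C D"
  shows "card S \<le> k"
proof (rule ccontr)
  assume "\<not> card S \<le> k"
  then obtain T where T: "T \<subseteq> S" "card T = k + 1"
    by (metis Suc_eq_plus1 not_less_eq_eq obtain_subset_with_card_n)
  have "clique T (disjointness_edges F)"
    unfolding clique_def doubleton_in_disjointness_edges_iff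
    using T(1) \<open>S \<subseteq> F\<close> disj by blast
  then show False
    using free T \<open>S \<subseteq> F\<close> unfolding complete_free_def by blast
qed

section \<open>Heights of vertices in a relation on a finite set\<close>

definition chain_below :: "('v \<Rightarrow> 'v \<Rightarrow> bool) \<Rightarrow> 'v set \<Rightarrow> 'v \<Rightarrow> 'v set \<Rightarrow> bool" where
  "chain_below R V v S \<longleftrightarrow> S \<subseteq> V \<and> v \<in> S \<and> (\<forall>u\<in>S. u \<noteq> v \<longrightarrow> R u v) \<and>
     (\<forall>x\<in>S. \<forall>y\<in>S. x \<noteq> y \<longrightarrow> R x y \<or> R y x)"

text \<open>A chain counts its top \<open>v\<close>, so heights start at 1. For \<open>v\<close>
  outside \<open>V\<close> there is no chain and \<open>Max\<close> is unspecified.\<close>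

definition chain_height :: "('v \<Rightarrow> 'v \<Rightarrow> bool) \<Rightarrow> 'v set \<Rightarrow> 'v \<Rightarrow> nat" where
  "chain_height R V v = Max (card ` Collect (chain_below R V v))"

lemma finite_chain_below: "finite V \<Longrightarrow> finite (Collect (chain_below R V v))"
  by (rule finite_subset[of _ "Pow V"]) (auto simp: chain_below_def)

lemma chain_height_attained:
  assumes "finite V" "v \<in> V"
  obtains S where "S \<subseteq> V" "v \<in> S" "\<And>u. u \<in> S \<Longrightarrow> u \<noteq> v \<Longrightarrow> R u v"
    "\<And>x y. x \<in> S \<Longrightarrow> y \<in> S \<Longrightarrow> x \<noteq> y \<Longrightarrow> R x y \<or> R y x" "card S = chain_height R V v"
proof -
  let ?A = "Collect (chain_below R V v)"
  have "{v} \<in> ?A" using assms(2) by (simp add: chain_below_def)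
  then have "card ` ?A \<noteq> {}" by blast
  then have "Max (card ` ?A) \<in> card ` ?A"
    using finite_imageI[OF finite_chain_below[OF assms(1)]] by (rule Max_in[rotated])
  then obtain S where S: "S \<in> ?A" "Max (card ` ?A) = card S" by (rule imageE)
  have S': "S \<subseteq> V" "v \<in> S" "\<forall>u\<in>S. u \<noteq> v \<longrightarrow> R u v"
     "\<forall>x\<in>S. \<forall>y\<in>S. x \<noteq> y \<longrightarrow> R x y \<or> R y x"
    using S(1) unfolding mem_Collect_eq chain_below_def by - (elim conjE; assumption)+
  show thesis
  proof (rule that)
    show "S \<subseteq> V" "v \<in> S" by (fact S')+
    show "R u v" if "u \<in> S" "u \<noteq> v" for u using S'(3) that by blast
    show "R x y \<or> R y x" if "x \<in> S" "y \<in> S" "x \<noteq> y" for x y using S'(4) that by blast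
    show "card S = chain_height R V v" using S(2) by (simp add: chain_height_def)
  qed
qed

lemma card_le_chain_height:
  assumes "finite V" "S \<subseteq> V" "v \<in> S" "\<And>u. u \<in> S \<Longrightarrow> u \<noteq> v \<Longrightarrow> R u v"
    "\<And>x y. x \<in> S \<Longrightarrow> y \<in> S \<Longrightarrow> x \<noteq> y \<Longrightarrow> R x y \<or> R y x"
  shows "card S \<le> chain_height R V v"
proof -
  have "chain_below R V v S" unfolding chain_below_def using assms(2-5) by blast
  then show ?thesis
    unfolding chain_height_def 
    by (intro Max_ge finite_imageI finite_chain_below[OF assms(1)] imageI CollectI)
qed

lemma chain_height_pos:
  assumes "finite V" "v \<in> V"
  shows "0 < chain_height R V v"
proof -
  have "card {v} \<le> chain_height R V v"
    using assms(1) by (rule card_le_chain_height) (use assms(2) in blast)+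
  then show ?thesis by simp
qed

text \<open>A longest chain ending at \<open>u\<close> can be extended by \<open>v\<close>:
  transitivity puts \<open>v\<close> above all of it, and irreflexivity makes \<open>v\<close> a new
  element.\<close>

lemma chain_height_less:
  assumes "finite V" "u \<in> V" "v \<in> V" "R u v"
    and irrefl: "\<And>x. x \<in> V \<Longrightarrow> \<not> R x x"
    and trans: "\<And>x y z. x \<in> V \<Longrightarrow> y \<in> V \<Longrightarrow> z \<in> V \<Longrightarrow> R x y \<Longrightarrow> R y z \<Longrightarrow> R x z"
  shows "chain_height R V u < chain_height R V v"
proof -
  obtain S where S: "S \<subseteq> V" "u \<in> S" "\<And>w. w \<in> S \<Longrightarrow> w \<noteq> u \<Longrightarrow> R w u"
    "\<And>x y. x \<in> S \<Longrightarrow> y \<in> S \<Longrightarrow> x \<noteq> y \<Longrightarrow> R x y \<or> R y x" "card S = chain_height R V u"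
    using chain_height_attained[OF assms(1,2)] by blast
  have Rv: "R w v" if "w \<in> S" for w
    using S(1) S(3)[OF that] assms(2-4) trans[of w u v] that by blast
  then have "v \<notin> S" using irrefl assms(3) by blast
  have "card (insert v S) \<le> chain_height R V v"
  proof (rule card_le_chain_height)
    show "R x y \<or> R y x" if "x \<in> insert v S" "y \<in> insert v S" "x \<noteq> y" for x y
      using that Rv S(4) by blast
  qed (use S(1) Rv assms(1,3) in auto)
  then show ?thesis
    using S(5) \<open>v \<notin> S\<close> finite_subset[OF S(1) assms(1)] by simp
qed

text \<open>The first projection is a continuous injection on the compact connected set
  \<open>C\<close>. Its image is therefore a compact interval and its inverse is continuous.\<close>

lemma x_monotone_curve_graph:
  assumes "curve C" "x_monotone C"
  obtains l r :: real and y where "l \<le> r" "continuous_on {l..r} y"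
    "\<And>p. p \<in> C \<longleftrightarrow> l \<le> fst p \<and> fst p \<le> r \<and> snd p = y (fst p)"
proof -
  obtain \<phi> where "path \<phi>" and C: "C = path_image \<phi>"
    using assms(1) curve_def by blast
  then have comp: "compact C" and conn: "connected C" and ne: "C \<noteq> {}"
    by (auto simp: compact_path_image connected_path_image)
  have inj: "inj_on fst C"
    using assms(2) unfolding x_monotone_def Uniq_def inj_on_def by blast
  have contfst: "continuous_on C fst" by (intro continuous_intros)
  have "connected (fst ` C)" "compact (fst ` C)"
    using comp conn contfst by (auto intro: compact_continuous_image connected_continuous_image)
  then obtain l r :: real where lr: "fst ` C = {l..r}"
    using connected_compact_interval_1[of "fst ` C"] by (auto simp: cbox_interval)
  with ne have "l \<le> r" by force
  let ?g = "inv_into C fst"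
  have "continuous_on {l..r} ?g"
    using continuous_on_inv[OF contfst comp, of ?g] inj lr by simp
  then have "continuous_on {l..r} (\<lambda>t. snd (?g t))" by (intro continuous_intros)
  moreover have "p \<in> C \<longleftrightarrow> l \<le> fst p \<and> fst p \<le> r \<and> snd p = snd (?g (fst p))" for p
  proof
    assume "p \<in> C"
    then show "l \<le> fst p \<and> fst p \<le> r \<and> snd p = snd (?g (fst p))"
      using lr inv_into_f_f[OF inj \<open>p \<in> C\<close>] imageI[OF \<open>p \<in> C\<close>, of fst] by simp
  next
    assume p: "l \<le> fst p \<and> fst p \<le> r \<and> snd p = snd (?g (fst p))"
    then have "fst p \<in> fst ` C" using lr by simp
    then have "?g (fst p) \<in> C" "fst (?g (fst p)) = fst p"
      by (auto intro: inv_into_into f_inv_into_f)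
    with p show "p \<in> C" by (metis prod.collapse)
  qed
  ultimately show thesis using that \<open>l \<le> r\<close> by blast
qed

lemma card_pairs_le: "card {(p, q). 0 < p \<and> 0 < q \<and> p + q \<le> k + 1} = (k + 1) choose 2"
proof -
  have "{(p, q). 0 < p \<and> 0 < q \<and> p + q \<le> k + 1} = (SIGMA p : {1..k}. {1..k + 1 - p})"
    by auto
  then have "card {(p, q). 0 < p \<and> 0 < q \<and> p + q \<le> k + 1} = (\<Sum>p=1..k. k + 1 - p)"
    by (simp only: card_SigmaI[OF finite_atLeastAtMost ballI[OF finite_atLeastAtMost]]) simp
  also have "\<dots> = (\<Sum>p=1..k. p)"
    by (subst sum.atLeastAtMost_rev) simp
  also have "\<dots> = (k + 1) choose 2"
    using gauss_sum_from_Suc_0[of k, where 'a = nat] by (simp add: choose_two mult.commute)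
  finally show ?thesis .
qed

theorem colors_suffice_upper: "colors_suffice k (k ^ 2 * ((k + 1) choose 2))"
  unfolding colors_suffice_def
proof (intro allI impI)
  fix F :: "(real \<times> real) set set"
  assume fin: "finite F" and curves: "\<forall>C\<in>F. curve C \<and> x_monotone C"
    and free: "complete_free (k + 1) F (disjointness_edges F)"
  have "\<forall>C\<in>F. \<exists>l r y. l \<le> r \<and> continuous_on {l..r} y \<and>
      (\<forall>p. p \<in> C \<longleftrightarrow> l \<le> fst p \<and> fst p \<le> r \<and> snd p = y (fst p))"
    using curves x_monotone_curve_graph by metis
  then obtain l r y where lr: "\<And>C. C \<in> F \<Longrightarrow> l C \<le> r C"
    and cont: "\<And>C. C \<in> F \<Longrightarrow> continuous_on {l C..r C} (y C)"
    and graph: "\<And>C p. C \<in> F \<Longrightarrow>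
      p \<in> C \<longleftrightarrow> l C \<le> fst p \<and> fst p \<le> r C \<and> snd p = y C (fst p)"
    by metis
  \<comment> \<open>Over intervals that do not meet, \<open>below\<close> holds vacuously in both
    directions; in general it is neither antisymmetric nor transitive.\<close>
  define below where "below A B \<longleftrightarrow>
    (\<forall>t. l A \<le> t \<longrightarrow> l B \<le> t \<longrightarrow> t \<le> r A \<longrightarrow> t \<le> r B \<longrightarrow> y A t < y B t)" for A B
  have below_disjnt: "disjnt A B" if "A \<in> F" "B \<in> F" "below A B" for A B
    using that(3) graph[OF that(1)] graph[OF that(2)]
    unfolding below_def disjnt_def by (metis disjoint_iff less_irrefl)
  have below_cases: "below A B \<or> below B A" if AB: "A \<in> F" "B \<in> F" "disjnt A B" for A B
  proof (rule ccontr)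
    assume "\<not> (below A B \<or> below B A)"
    then obtain s t where st: "s \<in> {l A..r A} \<inter> {l B..r B}" "t \<in> {l A..r A} \<inter> {l B..r B}"
      "y A s \<ge> y B s" "y B t \<ge> y A t" unfolding below_def by fastforce
    let ?I = "{l A..r A} \<inter> {l B..r B}"
    let ?h = "\<lambda>t. y A t - y B t"
    have "continuous_on ?I ?h"
      by (intro continuous_intros continuous_on_subset[OF cont[OF AB(1)]]
        continuous_on_subset[OF cont[OF AB(2)]]) auto
    moreover have "connected ?I" by (simp add: Int_atLeastAtMost)
    ultimately have "connected (?h ` ?I)" by (rule connected_continuous_image)
    then have "0 \<in> ?h ` ?I"
      using st(3,4) connectedD_interval[of "?h ` ?I" "?h t" "?h s" 0] imageI[OF st(1), of ?h]
        imageI[OF st(2), of ?h] by simp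
    then obtain u where "u \<in> ?I" "y A u = y B u" by auto
    then show False
      using AB(3) graph[OF AB(1), of "(u, y A u)"] graph[OF AB(2), of "(u, y A u)"]
      by (auto simp: disjnt_iff)
  qed
  have below_irrefl: "\<not> below A A" if "A \<in> F" for A
    using lr[OF that] unfolding below_def by auto
  define o1 where "o1 A B \<longleftrightarrow> l A \<le> l B \<and> r A \<le> r B \<and> below A B" for A B
  define o2 where "o2 A B \<longleftrightarrow> l B \<le> l A \<and> r B \<le> r A \<and> below A B" for A B
  define o3 where "o3 A B \<longleftrightarrow> l B \<le> l A \<and> r A \<le> r B \<and> below A B" for A B
  \<comment> \<open>The arguments are swapped: a chain of \<open>o4\<close> ending at
    \<open>C\<close> consists of curves above \<open>C\<close> with intervals inside that of
    \<open>C\<close>, while a chain of \<open>o3\<close> ending at \<open>C\<close> consists of such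
    curves below \<open>C\<close>.\<close>
  define o4 where "o4 B A \<longleftrightarrow> l A \<le> l B \<and> r B \<le> r A \<and> below A B" for A B
  note o_defs = o1_def o2_def o3_def o4_def
  have irrefl: "\<not> o1 A A" "\<not> o2 A A" "\<not> o3 A A" "\<not> o4 A A" if "A \<in> F" for A
    using below_irrefl that by (auto simp: o_defs)
  \<comment> \<open>The two inequalities keep the common part of the intervals of \<open>A\<close>
    and \<open>C\<close> inside the interval of \<open>B\<close>.\<close>
  have below_trans: "below A C" if "below A B" "below B C"
    "max (l A) (l C) \<ge> l B" "min (r A) (r C) \<le> r B" for A B C
    unfolding below_def
  proof (intro allI impI)
    fix t assume t: "l A \<le> t" "l C \<le> t" "t \<le> r A" "t \<le> r C"
    with that(3,4) have "l B \<le> t" "t \<le> r B" by auto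
    with t that(1,2) have "y A t < y B t" "y B t < y C t" unfolding below_def by auto
    then show "y A t < y C t" by simp
  qed
  have trans: "o1 A B \<Longrightarrow> o1 B C \<Longrightarrow> o1 A C" "o2 A B \<Longrightarrow> o2 B C \<Longrightarrow> o2 A C"
    "o3 A B \<Longrightarrow> o3 B C \<Longrightarrow> o3 A C" "o4 A B \<Longrightarrow> o4 B C \<Longrightarrow> o4 A C" for A B C
    unfolding o_defs using below_trans[of A B C] below_trans[of C B A] by auto
  have o_disjnt: "disjnt A B" if "A \<in> F" "B \<in> F" "o1 A B \<or> o2 A B \<or> o3 A B \<or> o4 A B" for A B
    using that below_disjnt[of A B] below_disjnt[of B A] disjnt_sym unfolding o_defs by metis
  have o_cases: "o1 A B \<or> o2 A B \<or> o3 A B \<or> o4 B A" if "below A B" for A B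
    using that by (auto simp: o_defs)
  define h where "h = (\<lambda>R C. chain_height R F C)"
  have h_pos: "0 < h R C" if "C \<in> F" for R C
    unfolding h_def using fin that by (rule chain_height_pos)
  have h_le: "h R C \<le> k" if C: "C \<in> F" and R: "\<And>A B. A \<in> F \<Longrightarrow> B \<in> F \<Longrightarrow> R A B \<Longrightarrow> disjnt A B"
    for R C
  proof -
    obtain S where S: "S \<subseteq> F" "\<And>x y. x \<in> S \<Longrightarrow> y \<in> S \<Longrightarrow> x \<noteq> y \<Longrightarrow> R x y \<or> R y x" "card S = h R C"
      unfolding h_def using chain_height_attained[OF fin C] by metis
    have "card S \<le> k"
      using free
    proof (rule card_le_if_complete_free)
      show "finite S" "S \<subseteq> F" using S(1) fin finite_subset by auto
      show "disjnt A B" if "A \<in> S" "B \<in> S" "A \<noteq> B" for A B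
        using S(1) S(2)[OF that] R[of A B] R[of B A] that disjnt_sym by blast
    qed
    with S show ?thesis by simp
  qed
  \<comment> \<open>Longest chains \<open>S\<close> for \<open>o3\<close> and \<open>T\<close> for
    \<open>o4\<close> share only \<open>C\<close>, since any other common curve would be below
    itself. Hence their union has \<open>card S + card T - 1\<close> elements.\<close>
  have h34: "h o3 C + h o4 C \<le> k + 1" if C: "C \<in> F" for C
  proof -
    obtain S where S: "S \<subseteq> F" "C \<in> S" "\<And>x. x \<in> S \<Longrightarrow> x \<noteq> C \<Longrightarrow> o3 x C"
      "\<And>x y. x \<in> S \<Longrightarrow> y \<in> S \<Longrightarrow> x \<noteq> y \<Longrightarrow> o3 x y \<or> o3 y x" "card S = h o3 C"
      unfolding h_def using chain_height_attained[OF fin C] by metis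
    obtain T where T: "T \<subseteq> F" "C \<in> T" "\<And>x. x \<in> T \<Longrightarrow> x \<noteq> C \<Longrightarrow> o4 x C"
      "\<And>x y. x \<in> T \<Longrightarrow> y \<in> T \<Longrightarrow> x \<noteq> y \<Longrightarrow> o4 x y \<or> o4 y x" "card T = h o4 C"
      unfolding h_def using chain_height_attained[OF fin C] by metis
    have finST: "finite S" "finite T" using S(1) T(1) fin finite_subset by auto
    have mixed: "below x z" if "x \<in> S" "z \<in> T" "x \<noteq> C" "z \<noteq> C" for x z
      using S(3)[OF that(1,3)] T(3)[OF that(2,4)]
      by (intro below_trans[of x C z]) (auto simp: o_defs)
    have mixed': "disjnt x z" if xz: "x \<in> S" "z \<in> T" "x \<noteq> z" for x z
    proof -
      have F: "x \<in> F" "z \<in> F" using xz S(1) T(1) by auto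
      consider "x = C" "z \<noteq> C" | "z = C" "x \<noteq> C" | "x \<noteq> C" "z \<noteq> C" using xz(3) by blast
      then show ?thesis
      proof cases
        case 1
        then show ?thesis using T(3)[OF xz(2)] o_disjnt F disjnt_sym by blast
      next
        case 2
        then show ?thesis using S(3)[OF xz(1)] o_disjnt F by blast
      next
        case 3
        then show ?thesis using mixed xz below_disjnt F by blast
      qed
    qed
    have "x = C" if "x \<in> S" "x \<in> T" for x
      using mixed[OF that] below_irrefl that(1) S(1) by blast
    then have "S \<inter> T = {C}" using S(2) T(2) by blast
    then have "card (S \<union> T) + 1 = card S + card T"
      using card_Un_Int[OF finST] by simp
    moreover have "card (S \<union> T) \<le> k"
      using free
    proof (rule card_le_if_complete_free)
      show "finite (S \<union> T)" "S \<union> T \<subseteq> F" using finST S T by auto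
      show "disjnt x z" if "x \<in> S \<union> T" "z \<in> S \<union> T" "x \<noteq> z" for x z
      proof -
        have "disjnt x z" if "x \<in> S" "z \<in> S"
          using S(1) S(4)[OF that \<open>x \<noteq> z\<close>] o_disjnt[of x z] o_disjnt[of z x] that disjnt_sym by blast
        moreover have "disjnt x z" if "x \<in> T" "z \<in> T"
          using T(1) T(4)[OF that \<open>x \<noteq> z\<close>] o_disjnt[of x z] o_disjnt[of z x] that disjnt_sym by blast
        ultimately show ?thesis
          using that mixed'[of x z] mixed'[of z x] disjnt_sym by blast
      qed
    qed
    ultimately show ?thesis using S(5) T(5) by simp
  qed
  define P where "P = {(p, q). 0 < p \<and> 0 < q \<and> p + q \<le> k + 1}"
  define K where "K = {1..k} \<times> {1..k} \<times> P"
  have "P \<subseteq> {..k + 1} \<times> {..k + 1}" by (auto simp: P_def)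
  then have "finite P" using finite_subset by blast
  then have "finite K" by (simp add: K_def)
  moreover have "card K = k ^ 2 * ((k + 1) choose 2)"
    using card_pairs_le[of k] by (simp add: K_def P_def card_cartesian_product power2_eq_square)
  ultimately obtain e where e: "bij_betw e K {..<k ^ 2 * ((k + 1) choose 2)}"
    using ex_bij_betw_finite_nat[of K] by (auto simp: lessThan_atLeast0)
  define c where "c C = (h o1 C, h o2 C, h o3 C, h o4 C)" for C
  have c_in: "c C \<in> K" if "C \<in> F" for C
  proof -
    have "h o1 C \<le> k" "h o2 C \<le> k" by (rule h_le[OF that]; blast intro: o_disjnt)+
    then show ?thesis
      using h_pos[OF that] h34[OF that] by (simp add: K_def P_def c_def Suc_le_eq)
  qed
  have c_neq: "c A \<noteq> c B" if "A \<in> F" "B \<in> F" "below A B" for A B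
  proof -
    have "o1 A B \<Longrightarrow> h o1 A < h o1 B"
      unfolding h_def using fin \<open>A \<in> F\<close> \<open>B \<in> F\<close>
      by (rule chain_height_less) (assumption | erule irrefl | erule (1) trans)+
    moreover have "o2 A B \<Longrightarrow> h o2 A < h o2 B"
      unfolding h_def using fin \<open>A \<in> F\<close> \<open>B \<in> F\<close>
      by (rule chain_height_less) (assumption | erule irrefl | erule (1) trans)+
    moreover have "o3 A B \<Longrightarrow> h o3 A < h o3 B"
      unfolding h_def using fin \<open>A \<in> F\<close> \<open>B \<in> F\<close>
      by (rule chain_height_less) (assumption | erule irrefl | erule (1) trans)+
    moreover have "o4 B A \<Longrightarrow> h o4 B < h o4 A"
      unfolding h_def using fin \<open>B \<in> F\<close> \<open>A \<in> F\<close>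
      by (rule chain_height_less) (assumption | erule irrefl | erule (1) trans)+
    ultimately show ?thesis using o_cases[OF that(3)] unfolding c_def by (metis less_irrefl prod.inject)
  qed
  have "proper_coloring (e \<circ> c) (k ^ 2 * ((k + 1) choose 2)) F (disjointness_edges F)"
    unfolding proper_coloring_def
  proof (intro conjI ballI impI)
    show "(e \<circ> c) ` F \<subseteq> {..<k ^ 2 * ((k + 1) choose 2)}"
      using e c_in by (auto simp: bij_betw_def)
    fix A B assume AB: "A \<in> F" "B \<in> F" "{A, B} \<in> disjointness_edges F"
    then have "disjnt A B" by (simp add: doubleton_in_disjointness_edges_iff)
    then have "c A \<noteq> c B" using below_cases[of A B] c_neq[of A B] c_neq[of B A] AB by metis
    then show "(e \<circ> c) A \<noteq> (e \<circ> c) B"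
      using e c_in AB by (auto simp: bij_betw_def inj_on_def)
  qed
  then show "\<exists>c. proper_coloring c (k ^ 2 * ((k + 1) choose 2)) F (disjointness_edges F)" by blast
qed

section \<open>A poset with chain intervals and large chromatic number\<close>

text \<open>Zykov's construction: \<open>zykov_set (Suc n)\<close> consists of \<open>n\<close> disjoint copies of \<open>zykov_set n\<close> and,
  for each choice of one vertex per copy, an apex above the chosen vertices.\<close>

datatype zykov = Copy nat zykov | Apex "zykov list"

fun zykov_less :: "zykov \<Rightarrow> zykov \<Rightarrow> bool" where
  "zykov_less (Copy i u) (Copy j v) \<longleftrightarrow> i = j \<and> zykov_less u v"
| "zykov_less (Copy i u) (Apex vs) \<longleftrightarrow> i < length vs \<and> (u = vs ! i \<or> zykov_less u (vs ! i))"
| "zykov_less (Apex us) v \<longleftrightarrow> False"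

fun zykov_set :: "nat \<Rightarrow> zykov set" where
  "zykov_set 0 = {}"
| "zykov_set (Suc n) = (\<lambda>(i, v). Copy i v) ` ({..<n} \<times> zykov_set n) \<union>
     Apex ` {vs. set vs \<subseteq> zykov_set n \<and> length vs = n}"

fun zykov_level :: "zykov \<Rightarrow> nat" where
  "zykov_level (Copy i v) = zykov_level v"
| "zykov_level (Apex vs) = length vs"

lemma finite_zykov_set: "finite (zykov_set n)"
  by (induction n) (auto simp: finite_lists_length_eq)

lemma zykov_level_less: "v \<in> zykov_set n \<Longrightarrow> zykov_level v < n"
  by (induction n arbitrary: v) (auto simp: less_SucI)

lemma zykov_level_mono:
  "u \<in> zykov_set n \<Longrightarrow> v \<in> zykov_set n \<Longrightarrow> zykov_less u v \<Longrightarrow> zykov_level u < zykov_level v"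
  by (induction n arbitrary: u v) (auto simp: zykov_level_less)

lemma zykov_less_trans: "zykov_less u v \<Longrightarrow> zykov_less v w \<Longrightarrow> zykov_less u w"
proof (induction u w arbitrary: v rule: zykov_less.induct)
  case (1 i u j w)
  then show ?case by (cases v) auto
next
  case (2 i u ws)
  then show ?case by (cases v) auto
next
  case (3 us w)
  then show ?case by (cases v) auto
qed

lemma zykov_less_irrefl: "\<not> zykov_less u u"
  by (induction u) auto

text \<open>Everything strictly between an element of copy \<open>i\<close> and
  \<open>Apex vs\<close> lies in copy \<open>i\<close> and is \<open>vs ! i\<close> or below it, so
  the claim reduces to that copy.\<close>

lemma zykov_interval_chain:
  assumes "zykov_less a b" "zykov_less b c" "zykov_less a x" "zykov_less x c"
  shows "x = b \<or> zykov_less x b \<or> zykov_less b x"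
  using assms
proof (induction a c arbitrary: b x rule: zykov_less.induct)
  case (1 i a j c)
  then show ?case by (cases b; cases x) auto
next
  case (2 i a vs)
  then show ?case by (cases b; cases x) auto
qed auto

section \<open>The cover graph and its colorings\<close>

definition zykov_cover :: "zykov \<Rightarrow> zykov \<Rightarrow> bool" where
  "zykov_cover u v \<longleftrightarrow> zykov_less u v \<and> (\<nexists>x. zykov_less u x \<and> zykov_less x v)"

lemma zykov_cover_Copy: "zykov_cover u v \<Longrightarrow> zykov_cover (Copy i u) (Copy i v)"
  unfolding zykov_cover_def by (auto elim: zykov_less.elims)

lemma zykov_cover_Apex:
  assumes "i < length vs"
  shows "zykov_cover (Copy i (vs ! i)) (Apex vs)"
proof -
  have "\<not> zykov_less x (Apex vs)" if "zykov_less (Copy i (vs ! i)) x" for x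
    using that zykov_less_irrefl zykov_less_trans by (cases x) auto
  then show ?thesis using assms by (auto simp: zykov_cover_def)
qed

text \<open>By induction each of the \<open>n\<close> copies shows at least \<open>n\<close> colors,
  so vertices of distinct colors can be chosen greedily, one per copy. The apex over this selection
  covers them all and needs a further color.\<close>

lemma zykov_many_colors:
  assumes "\<And>u v. u \<in> zykov_set n \<Longrightarrow> v \<in> zykov_set n \<Longrightarrow> zykov_cover u v \<Longrightarrow> f u \<noteq> f v"
  shows "n \<le> card (f ` zykov_set n)"
  using assms
proof (induction n arbitrary: f)
  case (Suc n)
  have copy: "n \<le> card ((\<lambda>v. f (Copy i v)) ` zykov_set n)" if "i < n" for i
    using that by (intro Suc.IH Suc.prems) (auto intro: zykov_cover_Copy)
  have "\<exists>vs. length vs = m \<and> set vs \<subseteq> zykov_set n \<and> inj_on (\<lambda>i. f (Copy i (vs ! i))) {..<m}"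
    if "m \<le> n" for m
    using that
  proof (induction m)
    case (Suc m)
    then obtain vs where vs: "length vs = m" "set vs \<subseteq> zykov_set n"
      "inj_on (\<lambda>i. f (Copy i (vs ! i))) {..<m}" by auto
    let ?used = "(\<lambda>i. f (Copy i (vs ! i))) ` {..<m}"
    have "card ?used < card ((\<lambda>v. f (Copy m v)) ` zykov_set n)"
      using card_image[OF vs(3)] copy[of m] Suc.prems by simp
    then have "\<not> (\<lambda>v. f (Copy m v)) ` zykov_set n \<subseteq> ?used"
      by (meson card_mono finite_imageI finite_lessThan leD)
    then obtain v where v: "v \<in> zykov_set n" "f (Copy m v) \<notin> ?used" by auto
    have "inj_on (\<lambda>i. f (Copy i ((vs @ [v]) ! i))) {..<Suc m}"
      using vs(1,3) v(2) by (force simp: lessThan_Suc inj_on_def nth_append image_iff)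
    then show ?case using vs v(1) by (intro exI[of _ "vs @ [v]"]) auto
  qed auto
  then obtain vs where vs: "length vs = n" "set vs \<subseteq> zykov_set n"
    "inj_on (\<lambda>i. f (Copy i (vs ! i))) {..<n}" by blast
  let ?used = "(\<lambda>i. f (Copy i (vs ! i))) ` {..<n}"
  have sub: "?used \<subseteq> f ` zykov_set (Suc n)" "f (Apex vs) \<in> f ` zykov_set (Suc n)"
    using vs by force+
  have "f (Apex vs) \<notin> ?used"
  proof
    assume "f (Apex vs) \<in> ?used"
    then obtain i where i: "i < n" "f (Copy i (vs ! i)) = f (Apex vs)" by auto
    moreover have "Copy i (vs ! i) \<in> zykov_set (Suc n)" "Apex vs \<in> zykov_set (Suc n)"
      using vs(1,2) i(1) nth_mem[of i vs] by (force simp: image_iff)+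
    ultimately show False using Suc.prems zykov_cover_Apex[of i vs] vs(1) by blast
  qed
  then have "Suc n = card (insert (f (Apex vs)) ?used)"
    using card_image[OF vs(3)] by simp
  also have "\<dots> \<le> card (f ` zykov_set (Suc n))"
    using sub by (intro card_mono finite_imageI finite_zykov_set) auto
  finally show ?case .
qed auto

section \<open>Lengths without long valley-free subsequences\<close>

text \<open>A label is a list \<open>[a, i, s, t]\<close>. The pair \<open>(a, i)\<close> names a block, an \<open>i \<times> i\<close> grid with coordinates
  \<open>(s, t)\<close>. In the lexicographic order of labels, both keys increase when \<open>a\<close> does and decrease when
  \<open>i\<close> does; inside a block exactly one of the two keys increases.\<close>

definition labels :: "nat \<Rightarrow> nat list set" where
  "labels k = {[a, i, s, t] | a i s t. a < k \<and> 0 < i \<and> i \<le> k - a \<and> s < i \<and> t < i}"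

definition right_key :: "nat \<Rightarrow> nat list \<Rightarrow> nat list" where
  "right_key k x = [x ! 0, k - x ! 1, x ! 2, k - x ! 3]"

definition left_key :: "nat \<Rightarrow> nat list \<Rightarrow> nat list" where
  "left_key k x = [x ! 0, k - x ! 1, k - x ! 2, x ! 3]"

lemma card_labels: "card (labels k) = (\<Sum>a<k. \<Sum>i=1..k - a. i ^ 2)"
  and finite_labels: "finite (labels k)"
proof -
  let ?X = "SIGMA a : {..<k}. SIGMA i : {1..k - a}. {..<i} \<times> {..<i}"
  have labels: "labels k = (\<lambda>(a, i, s, t). [a, i, s, t]) ` ?X"
    by (force simp: labels_def image_iff)
  have inj: "inj_on (\<lambda>(a, i, s, t). [a, i, s, t]) ?X"
    by (auto simp: inj_on_def)
  show "card (labels k) = (\<Sum>a<k. \<Sum>i=1..k - a. i ^ 2)"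
    unfolding labels card_image[OF inj] by (simp add: card_SigmaI power2_eq_square)
  show "finite (labels k)" unfolding labels by simp
qed

text \<open>Both sides equal \<open>k * (k + 1)^2 * (k + 2) / 12\<close>.\<close>

lemma real_card_labels: "real (card (labels k)) = (real k + 1) / 2 * real ((k + 2) choose 3)"
proof -
  have squares: "6 * (\<Sum>i=1..n. real i ^ 2) = real n * (real n + 1) * (2 * real n + 1)" for n
    by (induction n) (auto simp: algebra_simps power2_eq_square)
  have "12 * (\<Sum>a<k. \<Sum>i=1..k - a. real i ^ 2) = real k * (real k + 1) ^ 2 * (real k + 2)"
  proof (induction k)
    case (Suc k)
    \<comment> \<open>Splitting off \<open>a = 0\<close> and shifting \<open>a\<close> leaves the
      double sum for \<open>k\<close>.\<close>
    have "(\<Sum>a<Suc k. \<Sum>i=1..Suc k - a. real i ^ 2) =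
        (\<Sum>i=1..Suc k. real i ^ 2) + (\<Sum>a<k. \<Sum>i=1..k - a. real i ^ 2)"
      by (subst sum.lessThan_Suc_shift) simp
    then show ?case
      using Suc squares[of "Suc k"] by (simp add: algebra_simps power2_eq_square)
  qed simp
  moreover have "6 * real ((k + 2) choose 3) = (real k + 2) * (real k + 1) * real k"
  proof (induction k)
    case (Suc k)
    have "Suc k + 2 choose 3 = (k + 2 choose 2) + (k + 2 choose 3)"
      using binomial_Suc_Suc[of "k + 2" 2] by (simp add: numeral_3_eq_3 numeral_2_eq_2)
    moreover have "2 * (k + 2 choose 2) = (k + 2) * (k + 1)"
      by (simp add: choose_two)
    then have "real (2 * (k + 2 choose 2)) = real ((k + 2) * (k + 1))" by (rule arg_cong)
    then have "2 * real (k + 2 choose 2) = (real k + 2) * (real k + 1)"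
      by (simp only: of_nat_mult of_nat_add of_nat_numeral of_nat_1)
    ultimately show ?case using Suc by (simp add: algebra_simps)
  qed (simp add: numeral_3_eq_3)
  ultimately have "12 * (\<Sum>a<k. \<Sum>i=1..k - a. real i ^ 2) = (real k + 1) * (6 * real ((k + 2) choose 3))"
    by (simp only: power2_eq_square) (simp only: ac_simps)
  then show ?thesis by (simp add: card_labels)
qed

lemma label_bounds:
  assumes "x \<in> labels k"
  shows "x ! 0 < k" "0 < x ! 1" "x ! 1 \<le> k - x ! 0" "x ! 2 < x ! 1" "x ! 3 < x ! 1"
    and "x = [x ! 0, x ! 1, x ! 2, x ! 3]"
  using assms by (auto simp: labels_def numeral_3_eq_3 numeral_2_eq_2)

lemma label_less_iff:
  assumes "x \<in> labels k" "y \<in> labels k"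
  shows "x < y \<longleftrightarrow> x ! 0 < y ! 0 \<or> x ! 0 = y ! 0 \<and> (x ! 1 < y ! 1 \<or> x ! 1 = y ! 1 \<and>
      (x ! 2 < y ! 2 \<or> x ! 2 = y ! 2 \<and> x ! 3 < y ! 3))"
  by (subst label_bounds(6)[OF assms(1)], subst label_bounds(6)[OF assms(2)]) simp

text \<open>The first coordinate where the labels differ decides; subtraction from \<open>k\<close>
  strictly reverses it, as no coordinate exceeds \<open>k\<close>.\<close>

lemma label_keys:
  assumes "x \<in> labels k" "y \<in> labels k"
  shows "x ! 0 < y ! 0 \<Longrightarrow> right_key k x < right_key k y \<and> left_key k x < left_key k y"
    and "x ! 0 = y ! 0 \<Longrightarrow> x ! 1 < y ! 1 \<Longrightarrow>
      right_key k y < right_key k x \<and> left_key k y < left_key k x"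
    and "x ! 0 = y ! 0 \<Longrightarrow> x ! 1 = y ! 1 \<Longrightarrow> x ! 2 < y ! 2 \<Longrightarrow>
      right_key k x < right_key k y \<and> left_key k y < left_key k x"
    and "x ! 0 = y ! 0 \<Longrightarrow> x ! 1 = y ! 1 \<Longrightarrow> x ! 2 = y ! 2 \<Longrightarrow> x ! 3 < y ! 3 \<Longrightarrow>
      right_key k y < right_key k x \<and> left_key k x < left_key k y"
  using label_bounds(1-5)[OF assms(1)] label_bounds(1-5)[OF assms(2)]
  unfolding right_key_def left_key_def by (simp_all add: diff_less_mono2)

text \<open>The bound arises as \<open>A + (k - A - I) + I\<close>. Here \<open>A\<close> is the
  largest first coordinate in \<open>T\<close> and \<open>I\<close> the smallest grid size occurring
  with it; \<open>T1\<close>, \<open>T2\<close> and \<open>T3\<close> collect the labels with first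
  coordinate below \<open>A\<close>, those with \<open>A\<close> and a larger grid, and those of the
  block \<open>(A, I)\<close>.\<close>

lemma card_no_valley_le:
  assumes T: "T \<subseteq> labels k"
    and right: "\<And>x y z. x \<in> T \<Longrightarrow> y \<in> T \<Longrightarrow> z \<in> T \<Longrightarrow> x < y \<Longrightarrow> y < z \<Longrightarrow>
      \<not> (right_key k y < right_key k x \<and> right_key k y < right_key k z)"
    and left: "\<And>x y z. x \<in> T \<Longrightarrow> y \<in> T \<Longrightarrow> z \<in> T \<Longrightarrow> x < y \<Longrightarrow> y < z \<Longrightarrow>
      \<not> (left_key k y < left_key k x \<and> left_key k y < left_key k z)"
  shows "card T \<le> k"
proof (cases "T = {}")
  case False
  have fin: "finite T" using T finite_labels finite_subset by blast
  note lab = subsetD[OF T]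
  note bounds = label_bounds(1-5)[OF lab]
  note less_iff = label_less_iff[OF lab lab]
  note keys = label_keys[OF lab lab]
  define A where "A = Max ((\<lambda>x. x ! 0) ` T)"
  define T1 where "T1 = {x \<in> T. x ! 0 < A}"
  define T0 where "T0 = {x \<in> T. x ! 0 = A}"
  have "A \<in> (\<lambda>x. x ! 0) ` T" unfolding A_def using fin False by (intro Max_in) auto
  then obtain z where z: "z \<in> T" "z ! 0 = A" by auto
  have "x ! 0 \<le> A" if "x \<in> T" for x unfolding A_def using fin that by (intro Max_ge) auto
  then have split1: "T = T1 \<union> T0" unfolding T1_def T0_def by force
  \<comment> \<open>Of two labels with equal first coordinate the later is lower in some key. As
    \<open>z\<close> comes after both and is higher in both keys, this makes a valley.\<close>
  have "\<not> x < y" if "x \<in> T1" "y \<in> T1" "x ! 0 = y ! 0" for x y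
  proof
    assume "x < y"
    have xy: "x \<in> T" "y \<in> T" "y ! 0 < A" using that by (auto simp: T1_def)
    then have "y < z" using z less_iff[OF xy(2) z(1)] by simp
    have "right_key k y < right_key k z" "left_key k y < left_key k z"
      using keys(1)[OF xy(2) z(1)] xy(3) z(2) by simp_all
    moreover have "right_key k y < right_key k x \<or> left_key k y < left_key k x"
      using \<open>x < y\<close> that(3) keys(2-4)[OF xy(1,2)] less_iff[OF xy(1,2)] by auto
    ultimately show False
      using right[OF xy(1,2) z(1) \<open>x < y\<close> \<open>y < z\<close>] left[OF xy(1,2) z(1) \<open>x < y\<close> \<open>y < z\<close>] by blast
  qed
  then have "inj_on (\<lambda>x. x ! 0) T1" by (metis inj_onI linorder_neqE)
  moreover have "(\<lambda>x. x ! 0) ` T1 \<subseteq> {..<A}" by (auto simp: T1_def)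
  ultimately have card1: "card T1 \<le> A" using card_inj_on_le[of _ T1 "{..<A}"] by simp
  define I where "I = Min ((\<lambda>x. x ! 1) ` T0)"
  define T2 where "T2 = {x \<in> T0. I < x ! 1}"
  define T3 where "T3 = {x \<in> T0. x ! 1 = I}"
  have fin0: "finite T0" using fin T0_def by simp
  have "I \<in> (\<lambda>x. x ! 1) ` T0"
    unfolding I_def using fin0 z by (intro Min_in) (auto simp: T0_def)
  then obtain w where w: "w \<in> T" "w ! 0 = A" "w ! 1 = I" by (auto simp: T0_def)
  have "I \<le> x ! 1" if "x \<in> T0" for x unfolding I_def using fin0 that by (intro Min_le) auto
  then have split2: "T0 = T2 \<union> T3" unfolding T2_def T3_def by force
  \<comment> \<open>Here \<open>w\<close> comes before both and is higher in both keys, and of two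
    labels in one block the later is higher in some key.\<close>
  have "\<not> x < y" if "x \<in> T2" "y \<in> T2" "x ! 1 = y ! 1" for x y
  proof
    assume "x < y"
    have xy: "x \<in> T" "y \<in> T" "x ! 0 = A" "y ! 0 = A" "I < x ! 1"
      using that by (auto simp: T2_def T0_def)
    then have "w < x" using w less_iff[OF w(1) xy(1)] by simp
    have "right_key k x < right_key k w" "left_key k x < left_key k w"
      using keys(2)[OF w(1) xy(1)] xy(3,5) w(2,3) by simp_all
    moreover have "right_key k x < right_key k y \<or> left_key k x < left_key k y"
      using \<open>x < y\<close> that(3) xy(3,4) keys(3,4)[OF xy(1,2)] less_iff[OF xy(1,2)] by auto
    ultimately show False
      using right[OF w(1) xy(1,2) \<open>w < x\<close> \<open>x < y\<close>] left[OF w(1) xy(1,2) \<open>w < x\<close> \<open>x < y\<close>] by blast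
  qed
  then have "inj_on (\<lambda>x. x ! 1) T2" by (metis inj_onI linorder_neqE)
  moreover have "(\<lambda>x. x ! 1) ` T2 \<subseteq> {I<..k - A}"
    using bounds(3) by (force simp: T2_def T0_def)
  ultimately have card2: "card T2 \<le> k - A - I" using card_inj_on_le[of _ T2 "{I<..k - A}"] by simp
  \<comment> \<open>Either the labels of the block have distinct \<open>s\<close>, or two of them
    share \<open>s\<close>; then all do, and their \<open>t\<close> are distinct.\<close>
  have card3: "card T3 \<le> I"
  proof (cases "inj_on (\<lambda>x. x ! 2) T3")
    case True
    moreover have "(\<lambda>x. x ! 2) ` T3 \<subseteq> {..<I}" using bounds(4) by (force simp: T3_def T0_def)
    ultimately show ?thesis using card_inj_on_le[of _ T3 "{..<I}"] by simp
  next
    case False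
    then obtain x' y' where "x' \<in> T3" "y' \<in> T3" "x' ! 2 = y' ! 2" "x' \<noteq> y'"
      unfolding inj_on_def by blast
    then obtain x y where xy: "x \<in> T3" "y \<in> T3" "x ! 2 = y ! 2" "x < y"
      by (metis neq_iff)
    have in_T3: "u \<in> T" "u ! 0 = A" "u ! 1 = I" if "u \<in> T3" for u
      using that by (auto simp: T3_def T0_def)
    have key_xy: "right_key k y < right_key k x" "left_key k x < left_key k y"
      using xy in_T3 keys(4)[of x y] less_iff[of x y] by auto
    \<comment> \<open>A label with smaller \<open>s\<close> would make \<open>x\<close> a valley of
      the left key, one with larger \<open>s\<close> would make \<open>y\<close> a valley of the
      right key.\<close>
    have const: "u ! 2 = x ! 2" if u: "u \<in> T3" for u
    proof (rule ccontr)
      assume "u ! 2 \<noteq> x ! 2"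
      then consider "u ! 2 < x ! 2" | "y ! 2 < u ! 2" using xy(3) by linarith
      then show False
      proof cases
        case 1
        then have "u < x" using less_iff[of u x] in_T3 u xy by simp
        then have "left_key k x < left_key k u" using 1 u xy in_T3 keys(3)[of u x] by auto
        then show False
          using left[OF in_T3(1)[OF u] in_T3(1)[OF xy(1)] in_T3(1)[OF xy(2)] \<open>u < x\<close> xy(4)] key_xy by blast
      next
        case 2
        then have "y < u" using less_iff[of y u] in_T3 u xy by simp
        then have "right_key k y < right_key k u" using 2 u xy in_T3 keys(3)[of y u] by auto
        then show False
          using right[OF in_T3(1)[OF xy(1)] in_T3(1)[OF xy(2)] in_T3(1)[OF u] xy(4) \<open>y < u\<close>] key_xy by blast
      qed
    qed
    have "inj_on (\<lambda>x. x ! 3) T3"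
    proof (rule inj_onI, rule ccontr)
      fix u v assume uv: "u \<in> T3" "v \<in> T3" "u ! 3 = v ! 3" "u \<noteq> v"
      then have "\<not> u < v" "\<not> v < u" using less_iff[of u v] less_iff[of v u] in_T3 const[of u] const[of v] by auto
      then show False using uv(4) by auto
    qed
    moreover have "(\<lambda>x. x ! 3) ` T3 \<subseteq> {..<I}" using bounds(5) by (force simp: T3_def T0_def)
    ultimately show ?thesis using card_inj_on_le[of _ T3 "{..<I}"] by simp
  qed
  have "A < k" "I \<le> k - A" using bounds(1,3)[OF w(1)] w by auto
  have "card T \<le> card T1 + card T0" unfolding split1 by (rule card_Un_le)
  also have "card T0 \<le> card T2 + card T3" unfolding split2 by (rule card_Un_le)
  finally show ?thesis using card1 card2 card3 \<open>A < k\<close> \<open>I \<le> k - A\<close> by linarith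
qed simp

section \<open>Drawing curves with prescribed crossings\<close>

definition graph_on :: "real \<Rightarrow> real \<Rightarrow> (real \<Rightarrow> real) \<Rightarrow> (real \<times> real) set" where
  "graph_on a b f = (\<lambda>t. (t, f t)) ` {a..b}"

lemma curve_graph_on:
  assumes "a \<le> b" "continuous_on {a..b} f"
  shows "curve (graph_on a b f)"
proof -
  let ?\<phi> = "(\<lambda>t. (t, f t)) \<circ> linepath a b"
  have img: "path_image (linepath a b) = {a..b}"
    using assms(1) by (simp add: closed_segment_eq_real_ivl)
  have "path ?\<phi>"
    using assms(2) img by (intro path_continuous_image) (auto intro!: continuous_intros)
  moreover have "path_image ?\<phi> = graph_on a b f"
    unfolding path_image_compose img graph_on_def ..
  ultimately show ?thesis unfolding curve_def by blast
qed

lemma x_monotone_graph_on: "x_monotone (graph_on a b f)"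
  by (auto simp: x_monotone_def Uniq_def graph_on_def)

lemma Pair_in_graph_on: "(x, y) \<in> graph_on a b f \<longleftrightarrow> a \<le> x \<and> x \<le> b \<and> y = f x"
  by (auto simp: graph_on_def)

lemma disjnt_graph_on:
  "disjnt (graph_on a b f) (graph_on c d g) \<longleftrightarrow>
    (\<forall>t. a \<le> t \<longrightarrow> t \<le> b \<longrightarrow> c \<le> t \<longrightarrow> t \<le> d \<longrightarrow> f t \<noteq> g t)"
  by (auto simp: disjnt_iff Pair_in_graph_on)

section \<open>Piecewise linear interpolation at integer nodes\<close>

definition hat :: "int \<Rightarrow> real \<Rightarrow> real" where
  "hat i t = max 0 (1 - \<bar>t - of_int i\<bar>)"

definition interpolate :: "int \<Rightarrow> (int \<Rightarrow> real) \<Rightarrow> real \<Rightarrow> real" where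
  "interpolate n f t = (\<Sum>i = -n..n. f i * hat i t)"

lemma continuous_on_interpolate: "continuous_on S (interpolate n f)"
  unfolding interpolate_def hat_def by (intro continuous_intros)

lemma interpolate_of_int:
  assumes "\<bar>j\<bar> \<le> n"
  shows "interpolate n f (of_int j) = f j"
proof -
  have "hat i (of_int j) = (if i = j then 1 else 0)" for i
  proof -
    have "\<bar>real_of_int j - of_int i\<bar> = of_int \<bar>j - i\<bar>" by simp
    moreover have "i \<noteq> j \<Longrightarrow> 1 \<le> \<bar>j - i\<bar>" by arith
    then have "i \<noteq> j \<Longrightarrow> (1::real) \<le> of_int \<bar>j - i\<bar>" by linarith
    ultimately show ?thesis unfolding hat_def by auto
  qed
  then have "interpolate n f (of_int j) = (\<Sum>i = -n..n. if i = j then f i else 0)"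
    unfolding interpolate_def by (intro sum.cong) auto
  also have "\<dots> = f j" using \<open>\<bar>j\<bar> \<le> n\<close> by (subst sum.delta) (auto simp: abs_le_iff)
  finally show ?thesis .
qed

text \<open>As \<open>a\<close> and \<open>b\<close> are integers, nodes outside
  \<open>{a..b}\<close> have weight 0 at \<open>t\<close>. The node
  \<open>\<lfloor>t\<rfloor>\<close> has positive weight, which makes the inequality strict.\<close>

lemma interpolate_less:
  assumes "-n \<le> a" "b \<le> n" "of_int a \<le> t" "t \<le> of_int b"
    and less: "\<And>i. a \<le> i \<Longrightarrow> i \<le> b \<Longrightarrow> f i < g i"
  shows "interpolate n f t < interpolate n g t"
proof -
  have nonneg: "0 \<le> (g i - f i) * hat i t" for i
  proof (cases "a \<le> i \<and> i \<le> b")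
    case True
    then show ?thesis using less[of i] by (simp add: hat_def)
  next
    case False
    then have "i + 1 \<le> a \<or> b + 1 \<le> i" by linarith
    then have "of_int i + 1 \<le> (of_int a :: real) \<or> of_int b + 1 \<le> (of_int i :: real)" by linarith
    then have "hat i t = 0" using assms(3,4) unfolding hat_def by linarith
    then show ?thesis by simp
  qed
  have floor: "a \<le> \<lfloor>t\<rfloor>" "\<lfloor>t\<rfloor> \<le> b" using assms(3,4) by (auto simp: le_floor_iff floor_le_iff)
  have "0 < hat \<lfloor>t\<rfloor> t" unfolding hat_def by linarith
  then have "0 < (g \<lfloor>t\<rfloor> - f \<lfloor>t\<rfloor>) * hat \<lfloor>t\<rfloor> t" using less[OF floor] by simp
  then have "0 < (\<Sum>i = -n..n. (g i - f i) * hat i t)"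
    using floor assms(1,2) nonneg by (intro sum_pos2[of _ "\<lfloor>t\<rfloor>"]) auto
  also have "\<dots> = interpolate n g t - interpolate n f t"
    by (simp add: interpolate_def sum_subtractf left_diff_distrib)
  finally show ?thesis by simp
qed

lemma interpolate_crossing:
  assumes "\<bar>i\<bar> \<le> n" "\<bar>j\<bar> \<le> n" "f i < g i" "g j < f j"
  obtains t where "of_int (min i j) \<le> t" "t \<le> of_int (max i j)"
    "interpolate n f t = interpolate n g t"
proof -
  let ?h = "\<lambda>t. interpolate n f t - interpolate n g t"
  have "continuous_on {of_int (min i j)..of_int (max i j)} ?h"
    by (intro continuous_intros continuous_on_interpolate)
  then have "connected (?h ` {of_int (min i j)..of_int (max i j)})"
    by (rule connected_continuous_image) simp
  moreover have "?h (of_int i) \<in> ?h ` {of_int (min i j)..of_int (max i j)}"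
    "?h (of_int j) \<in> ?h ` {of_int (min i j)..of_int (max i j)}"
    by (intro imageI; simp)+
  moreover have "?h (of_int i) \<le> 0" "0 \<le> ?h (of_int j)"
    using assms by (simp_all add: interpolate_of_int)
  ultimately have "0 \<in> ?h ` {of_int (min i j)..of_int (max i j)}"
    by (rule connectedD_interval)
  then show thesis using that by auto
qed

text \<open>Data for one side of the axis: \<open>pos\<close> orders the curves along the axis,
  \<open>\<rho>\<close> gives their lengths, and \<open>E u v\<close> requires \<open>u\<close> to
  stay below \<open>v\<close>; unrelated curves have to cross. By \<open>no_valley\<close>,
  \<open>E\<close> is transitive at \<open>v\<close> unless \<open>v\<close> is shorter than both
  \<open>u\<close> and \<open>w\<close>.\<close>

locale grounded_arrangement =
  fixes V :: "'v set" and \<rho> :: "'v \<Rightarrow> nat" and E :: "'v \<Rightarrow> 'v \<Rightarrow> bool"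
    and pos :: "'v \<Rightarrow> nat" and L :: nat
  assumes fin: "finite V" and inj: "inj_on \<rho> V" and \<rho>_pos: "\<And>v. v \<in> V \<Longrightarrow> 0 < \<rho> v"
    and pos_less: "\<And>v. v \<in> V \<Longrightarrow> pos v < L"
    and mono: "\<And>u v. u \<in> V \<Longrightarrow> v \<in> V \<Longrightarrow> E u v \<Longrightarrow> pos u < pos v"
    and no_valley: "\<And>u v w. u \<in> V \<Longrightarrow> v \<in> V \<Longrightarrow> w \<in> V \<Longrightarrow> E u v \<Longrightarrow> E v w \<Longrightarrow>
      \<rho> u \<le> \<rho> v \<or> \<rho> w \<le> \<rho> v \<Longrightarrow> E u w"
begin

text \<open>The curve of \<open>w\<close> ends at abscissa \<open>2 * \<rho> w + 1\<close>. At the abscissas \<open>2 * \<rho> w\<close> and \<open>2 * \<rho> w + 1\<close> the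
  curves related to \<open>w\<close> are moved away from it by \<open>L\<close>, and the curve of \<open>w\<close> sweeps from above all
  remaining curves to below them. The last assumption of the locale is what prevents these shifts
  from reversing the order of two related curves.\<close>

definition height :: "'v \<Rightarrow> nat \<Rightarrow> real" where
  "height v j = real (pos v) +
    (if j < 2 then 0
     else if j div 2 = \<rho> v then if even j then real L else - real L
     else (if \<exists>w\<in>V. \<rho> w = j div 2 \<and> E w v then real L else 0)
        - (if \<exists>w\<in>V. \<rho> w = j div 2 \<and> E v w then real L else 0))"

text \<open>At the nodes of \<open>u\<close> the curve of \<open>v\<close> is pushed up, and at the
  nodes of \<open>v\<close> the curve of \<open>u\<close> is pushed down. A third curve that pushes
  \<open>u\<close> up also pushes \<open>v\<close> up, and one that pushes \<open>v\<close> down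
  also pushes \<open>u\<close> down, by \<open>no_valley\<close>.\<close>

lemma height_less:
  assumes uv: "u \<in> V" "v \<in> V" "E u v" and j: "j div 2 \<le> \<rho> u" "j div 2 \<le> \<rho> v"
  shows "height u j < height v j"
proof -
  have pos: "real (pos u) < real (pos v)" using mono uv by simp
  have "u \<noteq> v" using mono uv by blast
  then have neq: "\<rho> u \<noteq> \<rho> v" using inj uv by (auto dest: inj_onD)
  have asym: "\<not> E v u" using mono[of u v] mono[of v u] uv by fastforce
  consider "j < 2" | "2 \<le> j" "j div 2 = \<rho> u" | "2 \<le> j" "j div 2 = \<rho> v"
    | "2 \<le> j" "j div 2 < \<rho> u" "j div 2 < \<rho> v"
    using j by linarith
  then show ?thesis
  proof cases
    case 1
    then show ?thesis using pos by (simp add: height_def)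
  next
    case 2
    have "\<exists>w\<in>V. \<rho> w = j div 2 \<and> E w v" using 2 uv by auto
    moreover have "\<not> (\<exists>w\<in>V. \<rho> w = j div 2 \<and> E v w)"
      using 2 uv asym inj by (auto dest: inj_onD)
    ultimately have "height v j = real (pos v) + real L"
      using 2 neq by (auto simp: height_def)
    moreover have "height u j \<le> real (pos u) + real L" using 2 by (simp add: height_def)
    ultimately show ?thesis using pos by simp
  next
    case 3
    have "\<exists>w\<in>V. \<rho> w = j div 2 \<and> E u w" using 3 uv by auto
    moreover have "\<not> (\<exists>w\<in>V. \<rho> w = j div 2 \<and> E w u)"
      using 3 uv asym inj by (auto dest: inj_onD)
    ultimately have "height u j = real (pos u) - real L"
      using 3 neq by (auto simp: height_def)
    moreover have "height v j \<ge> real (pos v) - real L" using 3 by (simp add: height_def)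
    ultimately show ?thesis using pos by simp
  next
    case 4
    have "\<exists>w\<in>V. \<rho> w = j div 2 \<and> E w v" if "\<exists>w\<in>V. \<rho> w = j div 2 \<and> E w u"
      using that no_valley[of _ u v] uv 4 by (metis less_imp_le_nat)
    moreover have "\<exists>w\<in>V. \<rho> w = j div 2 \<and> E u w" if "\<exists>w\<in>V. \<rho> w = j div 2 \<and> E v w"
      using that no_valley[of u v _] uv 4 by (metis less_imp_le_nat)
    ultimately show ?thesis using 4 pos unfolding height_def by auto
  qed
qed

text \<open>Since \<open>\<rho>\<close> is injective, these nodes belong to \<open>w\<close> alone,
  so \<open>u\<close> is not shifted there. The shift of \<open>w\<close> by \<open>L\<close>
  exceeds any difference of positions.\<close>

lemma height_crossing:
  assumes "u \<in> V" "w \<in> V" "\<rho> w < \<rho> u" "\<not> E u w" "\<not> E w u"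
  shows "height u (2 * \<rho> w) < height w (2 * \<rho> w)"
    and "height w (2 * \<rho> w + 1) < height u (2 * \<rho> w + 1)"
proof -
  have no: "\<not> (\<exists>x\<in>V. \<rho> x = \<rho> w \<and> E x u)" "\<not> (\<exists>x\<in>V. \<rho> x = \<rho> w \<and> E u x)"
    using assms inj by (auto dest: inj_onD)
  have pos: "real (pos u) < real L" "real (pos w) < real L" "0 < \<rho> w"
    using pos_less \<rho>_pos assms by auto
  show "height u (2 * \<rho> w) < height w (2 * \<rho> w)"
    using no pos assms(3) by (auto simp: height_def)
  show "height w (2 * \<rho> w + 1) < height u (2 * \<rho> w + 1)"
    using no pos assms(3) by (auto simp: height_def)
qed

end

text \<open>The index \<open>True\<close> stands for the right side of the axis and
  \<open>False\<close> for the left. The sides are drawn independently and glued along the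
  axis.\<close>

theorem realization:
  fixes V :: "'v set" and \<rho> :: "bool \<Rightarrow> 'v \<Rightarrow> nat" and E :: "bool \<Rightarrow> 'v \<Rightarrow> 'v \<Rightarrow> bool"
    and pos :: "'v \<Rightarrow> nat"
  assumes arr: "\<And>b. grounded_arrangement V (\<rho> b) (E b) pos L"
  obtains C :: "'v \<Rightarrow> (real \<times> real) set" where "inj_on C V"
    "\<And>v. v \<in> V \<Longrightarrow> curve (C v) \<and> x_monotone (C v)"
    "\<And>u v. u \<in> V \<Longrightarrow> v \<in> V \<Longrightarrow> u \<noteq> v \<Longrightarrow>
      disjnt (C u) (C v) \<longleftrightarrow> (\<forall>b. E b u v) \<or> (\<forall>b. E b v u)"
proof -
  have fin: "finite V" using grounded_arrangement.fin[OF arr] by blast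
  define g where "g b = grounded_arrangement.height V (\<rho> b) (E b) pos L" for b
  note g_less = grounded_arrangement.height_less[OF arr, folded g_def]
  note g_crossing = grounded_arrangement.height_crossing[OF arr, folded g_def]
  define f where "f v i = (if 0 \<le> i then g True v (nat i) else g False v (nat (- i)))" for v i
  \<comment> \<open>The sides agree at node 0, where both heights are \<open>pos v\<close>.\<close>
  have f_neg: "f v (- int j) = g False v j" for v j
    by (cases "j = 0") (auto simp: f_def g_def grounded_arrangement.height_def[OF arr])
  have f_nonneg: "f v (int j) = g True v j" for v j by (simp add: f_def)
  define A where "A v = - int (2 * \<rho> False v + 1)" for v
  define B where "B v = int (2 * \<rho> True v + 1)" for v
  define m where "m = (\<Sum>v\<in>V. 2 * \<rho> False v + 1 + (2 * \<rho> True v + 1))"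
  define n where "n = int m"
  have n: "- n \<le> A v" "B v \<le> n" if "v \<in> V" for v
  proof -
    have "2 * \<rho> False v + 1 + (2 * \<rho> True v + 1) \<le> m"
      unfolding m_def using that fin by (intro member_le_sum) auto
    then show "- n \<le> A v" "B v \<le> n" by (simp_all add: n_def A_def B_def)
  qed
  have AB: "A v < 0" "0 < B v" for v by (simp_all add: A_def B_def)
  define C where "C v = graph_on (of_int (A v)) (of_int (B v)) (interpolate n (f v))" for v
  have above: "disjnt (C u) (C v)" if "u \<in> V" "v \<in> V" "\<And>b. E b u v" for u v
    unfolding C_def disjnt_graph_on
  proof (intro allI impI)
    fix t :: real
    assume t: "of_int (A u) \<le> t" "t \<le> of_int (B u)" "of_int (A v) \<le> t" "t \<le> of_int (B v)"
    have "f u i < f v i" if "max (A u) (A v) \<le> i" "i \<le> min (B u) (B v)" for i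
    proof (cases "0 \<le> i")
      case True
      then show ?thesis
        unfolding f_def using g_less[of u v True "nat i"] \<open>u \<in> V\<close> \<open>v \<in> V\<close> \<open>E True u v\<close> \<open>i \<le> _\<close>
        by (simp add: B_def) linarith
    next
      case False
      then show ?thesis
        unfolding f_def using g_less[of u v False "nat (- i)"] \<open>u \<in> V\<close> \<open>v \<in> V\<close> \<open>E False u v\<close> \<open>_ \<le> i\<close>
        by (simp add: A_def) linarith
    qed
    then have "interpolate n (f u) t < interpolate n (f v) t"
      using n that t by (intro interpolate_less[of n "max (A u) (A v)" "min (B u) (B v)"])
        (auto simp: max_def min_def)
    then show "interpolate n (f u) t \<noteq> interpolate n (f v) t" by simp
  qed
  have crossing: "\<not> disjnt (C u) (C w)"
    if uw: "u \<in> V" "w \<in> V" "\<rho> b w < \<rho> b u" "\<not> E b u w" "\<not> E b w u" for b u w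
  proof -
    define s where "s j = (if b then int j else - int j)" for j
    have f_s: "f v (s j) = g b v j" for v j
      by (cases b) (simp_all add: s_def f_neg f_nonneg)
    let ?i = "s (2 * \<rho> b w)" and ?j = "s (2 * \<rho> b w + 1)"
    have range: "A v \<le> ?i" "A v \<le> ?j" "?i \<le> B v" "?j \<le> B v" if "v = u \<or> v = w" for v
      using that uw(3) by (cases b; auto simp: s_def A_def B_def)+
    have "\<bar>?i\<bar> \<le> n" "\<bar>?j\<bar> \<le> n" using range[of u] n[OF uw(1)] by (auto simp: abs_le_iff)
    then obtain t where t: "of_int (min ?i ?j) \<le> t" "t \<le> of_int (max ?i ?j)"
      "interpolate n (f u) t = interpolate n (f w) t"
      using interpolate_crossing[of ?i n ?j "f u" "f w"] g_crossing[OF uw] f_s by metis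
    have "of_int (A v) \<le> t \<and> t \<le> of_int (B v)" if "v = u \<or> v = w" for v
    proof -
      have "A v \<le> min ?i ?j" "max ?i ?j \<le> B v" using range[OF that] by auto
      then have "real_of_int (A v) \<le> of_int (min ?i ?j)" "real_of_int (max ?i ?j) \<le> of_int (B v)"
        by (simp_all only: of_int_le_iff)
      then show ?thesis using t(1,2) by linarith
    qed
    then show ?thesis unfolding C_def disjnt_graph_on using t(3) by blast
  qed
  have "inj_on C V"
  proof (rule inj_onI)
    fix u v assume uv: "u \<in> V" "v \<in> V" "C u = C v"
    have "fst ` C x = {of_int (A x)..of_int (B x)}" for x
      by (simp add: C_def graph_on_def image_image)
    then have "{real_of_int (A u)..of_int (B u)} = {of_int (A v)..of_int (B v)}" using uv(3) by metis
    then have "B u = B v" using AB[of u] AB[of v] by (simp add: Icc_eq_Icc)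
    then have "\<rho> True u = \<rho> True v" by (simp add: B_def)
    then show "u = v" using grounded_arrangement.inj[OF arr, of True] uv by (auto dest: inj_onD)
  qed
  moreover have "curve (C v) \<and> x_monotone (C v)" for v
    unfolding C_def using AB[of v]
    by (auto intro!: curve_graph_on continuous_on_interpolate x_monotone_graph_on)
  moreover have "disjnt (C u) (C v) \<longleftrightarrow> (\<forall>b. E b u v) \<or> (\<forall>b. E b v u)"
    if uv: "u \<in> V" "v \<in> V" "u \<noteq> v" for u v
  proof
    assume "(\<forall>b. E b u v) \<or> (\<forall>b. E b v u)"
    then show "disjnt (C u) (C v)" using above uv disjnt_sym by blast
  next
    assume disj: "disjnt (C u) (C v)"
    show "(\<forall>b. E b u v) \<or> (\<forall>b. E b v u)"
    proof (rule ccontr)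
      assume "\<not> ((\<forall>b. E b u v) \<or> (\<forall>b. E b v u))"
      then obtain b b' where b: "\<not> E b u v" "\<not> E b' v u" by blast
      \<comment> \<open>The direction against \<open>pos\<close> fails on both sides, so on a side
        where the other direction fails too the curves are unrelated.\<close>
      have "\<exists>b. \<not> E b u v \<and> \<not> E b v u"
      proof (cases "pos u \<le> pos v")
        case True
        then have "\<not> E b v u" using grounded_arrangement.mono[OF arr uv(2,1)] by fastforce
        then show ?thesis using b by blast
      next
        case False
        then have "\<not> E b' u v" using grounded_arrangement.mono[OF arr uv(1,2)] by fastforce
        then show ?thesis using b by blast
      qed
      then obtain b where b: "\<not> E b u v" "\<not> E b v u" by blast
      have "\<rho> b u \<noteq> \<rho> b v" using grounded_arrangement.inj[OF arr, of b] uv by (auto dest: inj_onD)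
      then show False
        using crossing[of u v b] crossing[of v u b] b uv disj disjnt_sym by (metis nat_neq_iff)
    qed
  qed
  ultimately show thesis using that[of C] by blast
qed

section \<open>Assembling the bounds\<close>

text \<open>This turns list-valued keys into numeric lengths by counting smaller keys;
  \<open>Suc\<close> provides the positivity demanded by
  \<open>grounded_arrangement\<close>.\<close>

lemma obtain_ranking:
  fixes key :: "'v \<Rightarrow> 'k::linorder"
  assumes "finite V" "inj_on key V"
  obtains \<rho> :: "'v \<Rightarrow> nat" where "inj_on \<rho> V" "\<And>v. 0 < \<rho> v"
    "\<And>u v. u \<in> V \<Longrightarrow> v \<in> V \<Longrightarrow> \<rho> u < \<rho> v \<longleftrightarrow> key u < key v"
proof -
  define \<rho> where "\<rho> v = Suc (card {u \<in> V. key u < key v})" for v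
  have less: "\<rho> u < \<rho> v" if "u \<in> V" "key u < key v" for u v
  proof -
    have "{w \<in> V. key w < key u} \<subset> {w \<in> V. key w < key v}" using that by force
    then show ?thesis unfolding \<rho>_def using assms(1) by (auto intro: psubset_card_mono)
  qed
  have iff: "\<rho> u < \<rho> v \<longleftrightarrow> key u < key v" if "u \<in> V" "v \<in> V" for u v
  proof (cases "key u" "key v" rule: linorder_cases)
    case equal
    then show ?thesis by (simp add: \<rho>_def)
  qed (use less[of u v] less[of v u] that in auto)
  have "inj_on \<rho> V"
  proof (rule inj_onI)
    fix u v assume uv: "u \<in> V" "v \<in> V" "\<rho> u = \<rho> v"
    then have "key u = key v" using iff by (metis less_irrefl linorder_neqE)
    then show "u = v" using assms(2) uv by (auto dest: inj_onD)
  qed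
  then show thesis using that[of \<rho>] iff by (simp add: \<rho>_def)
qed

text \<open>Closing the cover relation under the condition of \<open>grounded_arrangement\<close> adds exactly the
  pairs whose open interval lies, in the order by \<open>\<rho>\<close>, above one of its endpoints.\<close>

definition zykov_edge :: "nat \<Rightarrow> (zykov \<Rightarrow> nat) \<Rightarrow> zykov \<Rightarrow> zykov \<Rightarrow> bool" where
  "zykov_edge N \<rho> u v \<longleftrightarrow> zykov_less u v \<and>
     (\<forall>x\<in>zykov_set N. zykov_less u x \<longrightarrow> zykov_less x v \<longrightarrow> \<rho> u \<le> \<rho> x \<or> \<rho> v \<le> \<rho> x)"

text \<open>As intervals are chains, any \<open>x\<close> between \<open>u\<close> and
  \<open>w\<close> is \<open>v\<close> or lies in the interval of one of the given edges. If the
  condition there only yields \<open>\<rho> v \<le> \<rho> x\<close>, the hypothesis on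
  \<open>v\<close> passes it on to \<open>u\<close> or \<open>w\<close>.\<close>

lemma zykov_edge_no_valley:
  assumes uvw: "zykov_edge N \<rho> u v" "zykov_edge N \<rho> v w" and \<rho>: "\<rho> u \<le> \<rho> v \<or> \<rho> w \<le> \<rho> v"
  shows "zykov_edge N \<rho> u w"
  unfolding zykov_edge_def
proof (intro conjI ballI impI)
  have less: "zykov_less u v" "zykov_less v w" using uvw by (auto simp: zykov_edge_def)
  then show "zykov_less u w" by (rule zykov_less_trans)
  fix x assume x: "x \<in> zykov_set N" "zykov_less u x" "zykov_less x w"
  consider "x = v" | "zykov_less x v" | "zykov_less v x"
    using zykov_interval_chain[OF less x(2,3)] by blast
  then show "\<rho> u \<le> \<rho> x \<or> \<rho> w \<le> \<rho> x"
  proof cases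
    case 1
    then show ?thesis using \<rho> by simp
  next
    case 2
    then have "\<rho> u \<le> \<rho> x \<or> \<rho> v \<le> \<rho> x" using uvw(1) x by (auto simp: zykov_edge_def)
    then show ?thesis using \<rho> by linarith
  next
    case 3
    then have "\<rho> v \<le> \<rho> x \<or> \<rho> w \<le> \<rho> x" using uvw(2) x by (auto simp: zykov_edge_def)
    then show ?thesis using \<rho> by linarith
  qed
qed

text \<open>All keys have length 4, so the comparison is decided before the appended lists are
  reached.\<close>

lemma key_less_append:
  "right_key k x < right_key k y \<Longrightarrow> right_key k x @ is < right_key k y @ js"
  "left_key k x < left_key k y \<Longrightarrow> left_key k x @ is < left_key k y @ js"
  by (auto simp: right_key_def left_key_def)

theorem colors_suffice_lower:
  assumes "colors_suffice k m"
  shows "card (labels k) \<le> m"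
proof -
  define N where "N = card (labels k)"
  define V where "V = zykov_set N"
  \<comment> \<open>There are as many levels as labels; level \<open>j\<close> receives the label at
    index \<open>j\<close> in increasing order, so labels increase along chains.\<close>
  define lab where "lab v = sorted_list_of_set (labels k) ! zykov_level v" for v
  have finV: "finite V" by (simp add: V_def finite_zykov_set)
  have lab_in: "lab v \<in> labels k" if "v \<in> V" for v
    using that zykov_level_less[of v N] nth_mem[of "zykov_level v" "sorted_list_of_set (labels k)"]
    by (simp add: lab_def V_def N_def finite_labels)
  have lab_less: "lab u < lab v" if "u \<in> V" "v \<in> V" "zykov_less u v" for u v
    unfolding lab_def using that zykov_level_mono[of u N v] zykov_level_less[of v N]
    by (intro sorted_wrt_nth_less[OF strict_sorted_list_of_set]) (auto simp: V_def N_def)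
  \<comment> \<open>\<open>idx\<close> only breaks ties between vertices with equal labels, which are never comparable.\<close>
  obtain idx :: "zykov \<Rightarrow> nat" where idx: "inj_on idx V"
    using finite_imp_inj_to_nat_seg[OF finV] by blast
  define key where "key b v = (if b then right_key k (lab v) else left_key k (lab v)) @ [idx v]" for b v
  have "inj_on (key b) V" for b
    using idx by (auto simp: inj_on_def key_def)
  then have "\<forall>b. \<exists>\<rho> :: zykov \<Rightarrow> nat. inj_on \<rho> V \<and> (\<forall>v. 0 < \<rho> v) \<and>
      (\<forall>u\<in>V. \<forall>v\<in>V. \<rho> u < \<rho> v \<longleftrightarrow> key b u < key b v)"
    using obtain_ranking[OF finV] by metis
  then obtain \<rho> :: "bool \<Rightarrow> zykov \<Rightarrow> nat" where \<rho>: "\<And>b. inj_on (\<rho> b) V" "\<And>b v. 0 < \<rho> b v"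
    "\<And>b u v. u \<in> V \<Longrightarrow> v \<in> V \<Longrightarrow> \<rho> b u < \<rho> b v \<longleftrightarrow> key b u < key b v"
    by metis
  define E where "E b = zykov_edge N (\<rho> b)" for b
  have E_less: "zykov_less u v" if "E b u v" for b u v using that by (simp add: E_def zykov_edge_def)
  have arr: "grounded_arrangement V (\<rho> b) (E b) zykov_level N" for b
  proof
    show "E b u w" if "E b u v" "E b v w" "\<rho> b u \<le> \<rho> b v \<or> \<rho> b w \<le> \<rho> b v" for u v w
      using that zykov_edge_no_valley unfolding E_def by blast
  qed (use finV \<rho> zykov_level_less zykov_level_mono E_less in \<open>auto simp: V_def\<close>)
  obtain C where C: "inj_on C V" "\<And>v. v \<in> V \<Longrightarrow> curve (C v) \<and> x_monotone (C v)"
    "\<And>u v. u \<in> V \<Longrightarrow> v \<in> V \<Longrightarrow> u \<noteq> v \<Longrightarrow>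
      disjnt (C u) (C v) \<longleftrightarrow> (\<forall>b. E b u v) \<or> (\<forall>b. E b v u)"
    by (rule realization[where \<rho> = \<rho> and E = E, OF arr]) (rule that)
  have free: "complete_free (k + 1) (C ` V) (disjointness_edges (C ` V))"
    unfolding complete_free_def
  proof
    assume "\<exists>S\<subseteq>C ` V. card S = k + 1 \<and> clique S (disjointness_edges (C ` V))"
    then obtain W where W: "W \<subseteq> V" "card (C ` W) = k + 1"
      "clique (C ` W) (disjointness_edges (C ` V))"
      by (metis subset_image_iff)
    have injW: "inj_on C W" using C(1) W(1) inj_on_subset by blast
    have adj: "(\<forall>b. E b u v) \<or> (\<forall>b. E b v u)" if "u \<in> W" "v \<in> W" "u \<noteq> v" for u v
    proof -
      have "C u \<noteq> C v" using injW that by (auto dest: inj_onD)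
      then have "disjnt (C u) (C v)"
        using W(3) that by (auto simp: clique_def doubleton_in_disjointness_edges_iff)
      then show ?thesis using C(3)[of u v] that W(1) by blast
    qed
    have lab_cases: "zykov_less u v \<and> (\<forall>b. E b u v)" if "u \<in> W" "v \<in> W" "lab u < lab v" for u v
    proof -
      have "\<not> zykov_less v u" using lab_less[of v u] that W(1) by fastforce
      then show ?thesis using adj[of u v] that E_less by blast
    qed
    have inj_lab: "inj_on lab W"
    proof (rule inj_onI, rule ccontr)
      fix u v assume uv: "u \<in> W" "v \<in> W" "lab u = lab v" "u \<noteq> v"
      then have "zykov_less u v \<or> zykov_less v u" using adj[of u v] E_less by blast
      then show False using lab_less[of u v] lab_less[of v u] uv W(1) by auto
    qed
    \<comment> \<open>The vertex \<open>v\<close> lies between the adjacent vertices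
      \<open>u\<close> and \<open>w\<close>, and \<open>zykov_edge\<close> forbids it to be shorter
      than both.\<close>
    have no_valley: "\<not> (\<rho> b v < \<rho> b u \<and> \<rho> b v < \<rho> b w)"
      if "u \<in> W" "v \<in> W" "w \<in> W" "lab u < lab v" "lab v < lab w" for b u v w
    proof -
      have "lab u < lab w" using that(4,5) by (rule less_trans)
      then have "E b u w" "zykov_less u v" "zykov_less v w"
        using lab_cases that by blast+
      moreover have "v \<in> zykov_set N" using that(2) W(1) by (auto simp: V_def)
      ultimately have "\<rho> b u \<le> \<rho> b v \<or> \<rho> b w \<le> \<rho> b v"
        by (simp add: E_def zykov_edge_def)
      then show ?thesis by linarith
    qed
    have right: "\<rho> True u < \<rho> True v" if "u \<in> V" "v \<in> V" "right_key k (lab u) < right_key k (lab v)" for u v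
      using that \<rho>(3)[of u v True] key_less_append(1) by (simp add: key_def)
    have left: "\<rho> False u < \<rho> False v" if "u \<in> V" "v \<in> V" "left_key k (lab u) < left_key k (lab v)" for u v
      using that \<rho>(3)[of u v False] key_less_append(2) by (simp add: key_def)
    have "card (lab ` W) \<le> k"
    proof (rule card_no_valley_le)
      show "lab ` W \<subseteq> labels k" using lab_in W(1) by blast
      fix x y z assume "x \<in> lab ` W" "y \<in> lab ` W" "z \<in> lab ` W" "x < y" "y < z"
      then obtain u v w where uvw: "u \<in> W" "v \<in> W" "w \<in> W" "x = lab u" "y = lab v" "z = lab w"
        "lab u < lab v" "lab v < lab w" by blast
      then have V: "u \<in> V" "v \<in> V" "w \<in> V" using W(1) by auto
      show "\<not> (right_key k y < right_key k x \<and> right_key k y < right_key k z)"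
        using no_valley[OF uvw(1-3,7,8), of True] right[OF V(2,1)] right[OF V(2,3)] uvw(4-6) by blast
      show "\<not> (left_key k y < left_key k x \<and> left_key k y < left_key k z)"
        using no_valley[OF uvw(1-3,7,8), of False] left[OF V(2,1)] left[OF V(2,3)] uvw(4-6) by blast
    qed
    then show False using W(2) card_image[OF injW] card_image[OF inj_lab] by simp
  qed
  have "\<forall>D\<in>C ` V. curve D \<and> x_monotone D" "finite (C ` V)" using C(2) finV by auto
  then obtain c where c: "proper_coloring c m (C ` V) (disjointness_edges (C ` V))"
    using assms free unfolding colors_suffice_def by blast
  have "N \<le> card ((\<lambda>v. c (C v)) ` zykov_set N)"
  proof (rule zykov_many_colors)
    fix u v assume uv: "u \<in> zykov_set N" "v \<in> zykov_set N" "zykov_cover u v"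
    \<comment> \<open>A covering pair has an empty open interval, so the condition on lengths is
      vacuous on both sides.\<close>
    then have "E b u v" for b by (auto simp: E_def zykov_edge_def zykov_cover_def)
    moreover have "u \<noteq> v" using uv(3) zykov_less_irrefl by (auto simp: zykov_cover_def)
    ultimately have "disjnt (C u) (C v)" "C u \<noteq> C v"
      using C(1) C(3)[of u v] uv(1,2) by (auto simp: V_def dest: inj_onD)
    then have "{C u, C v} \<in> disjointness_edges (C ` V)"
      using uv(1,2) by (simp add: doubleton_in_disjointness_edges_iff V_def)
    then show "c (C u) \<noteq> c (C v)"
      using c uv(1,2) unfolding proper_coloring_def V_def by blast
  qed
  also have "\<dots> \<le> card {..<m}"
    using c by (intro card_mono) (auto simp: proper_coloring_def V_def)
  finally show ?thesis by (simp add: N_def)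
qed

theorem theorem5:
  fixes k :: nat
  assumes "k > 0"
  shows "(\<exists>m. colors_suffice k m)
    \<and> (real k + 1) / 2 * real ((k + 2) choose 3) \<le> real (color_bound k)
    \<and> real (color_bound k) \<le> real (k ^ 2 * ((k + 1) choose 2))"
proof (intro conjI)
  show ex: "\<exists>m. colors_suffice k m" using colors_suffice_upper by blast
  have "colors_suffice k (color_bound k)"
    unfolding color_bound_def using ex by (rule LeastI_ex)
  then show "(real k + 1) / 2 * real ((k + 2) choose 3) \<le> real (color_bound k)"
    using colors_suffice_lower real_card_labels by (metis of_nat_le_iff)
  show "real (color_bound k) \<le> real (k ^ 2 * ((k + 1) choose 2))"
    unfolding color_bound_def of_nat_le_iff by (rule Least_le) (rule colors_suffice_upper)
qed

end
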